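(* Let $P=(X,\leq_P)$ be a connected finite poset with at least two minimal points and at least two maximal points, and let $C$ be a 4-crown with $L(C)=\{a,b\}$ and $U(C)=\{v,w\}$. \begin{enumerate} \item There exists a surjective order homomorphism from $P$ onto $C$ if and only if there exists a separating homomorphism from $\mathfrak{F}(P)$ to $\mathfrak{C}$. \item If $C\subseteq E(P)$ (i.e. $C$ is a 4-crown of $P$ all of whose points are extremal points of $P$), then $C$ is a retract of $P$ if and only if there exists a $C$-separating homomorphism from $\mathfrak{F}(P)$ to $\mathfrak{C}$. \end{enumerate}
   Context: All posets are finite and nonempty; subsets of a poset are identified with the induced subposets. For a poset $P=(X,\leq_P)$: $L(P)$ and $U(P)$ are the sets of minimal and maximal points, $E(P)=L(P)\cup U(P)$, $M(P)=X\setminus E(P)$; ${\downarrow}_P y=\{x: x\leq_P y\}$, ${\uparrow}_P y=\{x: y\leq_P x\}$, $[x,y]_P={\uparrow}_P x\cap{\downarrow}_P y$. The comparability graph of $Y\subseteq X$ has vertex set $Y$ and an edge $\{x,y\}$ for each pair of distinct comparable elements; $Y$ is a crown if its comparability graph is a cycle; an $n$-crown is a crown with $n$ points. A 4-crown $D=\{a,b,v,w\}$ with $L(D)=\{a,b\}$, $U(D)=\{v,w\}$ has inner $\mathcal{I}_P(D)=[a,v]_P\cap[b,w]_P$; $D$ is improper if $\mathcal{I}_P(D)\neq\emptyset$ and proper otherwise. An (order) homomorphism is an order-preserving map; a retraction of $P$ is an idempotent homomorphism $r:P\to P$ and its image (as induced subposet) is a retract of $P$. For the fixed 4-crown $C$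 with $L(C)=\{a,b\}$, $U(C)=\{v,w\}$: $\mathcal{C}_{23}$ is the set of subsets of $C$ with 2 or 3 elements that are connected as induced subposets of $C$ (namely $\{a,v\},\{a,w\},\{b,v\},\{b,w\}$ and $abv,abw,avw,bvw$, where $xyz$ denotes $\{x,y,z\}$). $\mathfrak{C}$ is the undirected multigraph with vertex set $\mathcal{C}_{23}$ having, for $S,T\in\mathcal{C}_{23}$ (including $S=T$, giving loops), an L-edge between $S$ and $T$ iff $L(C)\cap S\cap T\neq\emptyset$ and a U-edge iff $U(C)\cap S\cap T\neq\emptyset$. Let $\mathcal{A}=\{S\in\mathcal{C}_{23}: L(C)\cap S=\{a\}\}$, $\mathcal{B}=\{S: L(C)\cap S=\{b\}\}$, $\mathcal{V}=\{S: U(C)\cap S=\{v\}\}$, $\mathcal{W}=\{S: U(C)\cap S=\{w\}\}$. $\mathcal{F}(P)$ is the set of improper 4-crowns of $P$ contained in $E(P)$, and $\mathfrak{F}(P)$ is the multigraph with vertex set $\mathcal{F}(P)$ having an L-edge between $F,G$ iff $L(P)\cap F\cap G\neq\emptyset$ and a U-edge iff $U(P)\cap F\cap G\neq\emptyset$. A homomorphism $\phi:\mathfrak{F}(P)\to\mathfrak{C}$ is a map $\mathcal{F}(P)\to\mathcal{C}_{23}$ such that L-edges (U-edges) between $F,G$ imply L-edges (U-edges) between $\phi(F),\phi(G)$. Such $\phi$ is separating if there exist $x\neq x'$ in $L(P)$ and $y\neq y'$ in $U(P)$ such that for all $F\in\mathcal{F}(P)$: $x\in F\Rightarrow\phi(F)\notin\mathcal{A}$;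 $x'\in F\Rightarrow\phi(F)\notin\mathcal{B}$; $y\in F\Rightarrow\phi(F)\notin\mathcal{V}$; $y'\in F\Rightarrow\phi(F)\notin\mathcal{W}$. It is $D$-separating, for a 4-crown $D\subseteq E(P)$, if it is separating with witnesses satisfying $\{x,x',y,y'\}=D$. *)

theory Defs
  imports Main "HOL-Library.FuncSet"
begin

text \<open>
  A poset is given by a carrier set and an order predicate which is only ever evaluated on the
  carrier. Hence the subposet of \<open>(X, le)\<close> induced by \<open>Y \<subseteq> X\<close> is \<open>(Y, le)\<close>, and every
  notion below applies to induced subposets without restricting \<open>le\<close>.
\<close>

definition finite_poset :: "'a set \<Rightarrow> ('a \<Rightarrow> 'a \<Rightarrow> bool) \<Rightarrow> bool" where
  "finite_poset X le \<longleftrightarrow>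
     finite X \<and> X \<noteq> {} \<and> reflp_on X le \<and> antisymp_on X le \<and> transp_on X le"

definition min_points :: "'a set \<Rightarrow> ('a \<Rightarrow> 'a \<Rightarrow> bool) \<Rightarrow> 'a set" where
  "min_points X le = {x \<in> X. \<forall>y\<in>X. le y x \<longrightarrow> y = x}"

definition max_points :: "'a set \<Rightarrow> ('a \<Rightarrow> 'a \<Rightarrow> bool) \<Rightarrow> 'a set" where
  "max_points X le = {x \<in> X. \<forall>y\<in>X. le x y \<longrightarrow> y = x}"

definition ext_points :: "'a set \<Rightarrow> ('a \<Rightarrow> 'a \<Rightarrow> bool) \<Rightarrow> 'a set" where
  "ext_points X le = min_points X le \<union> max_points X le"

definition down_set :: "'a set \<Rightarrow> ('a \<Rightarrow> 'a \<Rightarrow> bool) \<Rightarrow> 'a \<Rightarrow> 'a set" where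
  "down_set X le y = {x \<in> X. le x y}"

definition up_set :: "'a set \<Rightarrow> ('a \<Rightarrow> 'a \<Rightarrow> bool) \<Rightarrow> 'a \<Rightarrow> 'a set" where
  "up_set X le y = {x \<in> X. le y x}"

definition interval :: "'a set \<Rightarrow> ('a \<Rightarrow> 'a \<Rightarrow> bool) \<Rightarrow> 'a \<Rightarrow> 'a \<Rightarrow> 'a set" where
  "interval X le x y = up_set X le x \<inter> down_set X le y"

definition comparability_edge :: "'a set \<Rightarrow> ('a \<Rightarrow> 'a \<Rightarrow> bool) \<Rightarrow> 'a \<Rightarrow> 'a \<Rightarrow> bool" where
  "comparability_edge Y le x y \<longleftrightarrow> x \<in> Y \<and> y \<in> Y \<and> x \<noteq> y \<and> (le x y \<or> le y x)"

definition connected_poset :: "'a set \<Rightarrow> ('a \<Rightarrow> 'a \<Rightarrow> bool) \<Rightarrow> bool" where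
  "connected_poset Y le \<longleftrightarrow> (\<forall>x\<in>Y. \<forall>y\<in>Y. (comparability_edge Y le)\<^sup>*\<^sup>* x y)"

text \<open>A crown is a poset whose comparability graph is a cycle (of length at least 3).\<close>

definition crown :: "'a set \<Rightarrow> ('a \<Rightarrow> 'a \<Rightarrow> bool) \<Rightarrow> bool" where
  "crown Y le \<longleftrightarrow>
     (\<exists>n\<ge>3. \<exists>f. bij_betw f {..<n} Y \<and>
        (\<forall>i<n. \<forall>j<n. comparability_edge Y le (f i) (f j) \<longleftrightarrow>
           j = Suc i mod n \<or> i = Suc j mod n))"

definition n_crown :: "nat \<Rightarrow> 'a set \<Rightarrow> ('a \<Rightarrow> 'a \<Rightarrow> bool) \<Rightarrow> bool" where
  "n_crown n Y le \<longleftrightarrow> crown Y le \<and> card Y = n"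

text \<open>
  The inner of a 4-crown with minimal points \<open>a, b\<close> and maximal points \<open>v, w\<close>. On a poset it is
  invariant under swapping \<open>a, b\<close> and under swapping \<open>v, w\<close>, so the choice of the labelling in
  \<open>improper_4crown\<close> does not matter.
\<close>

definition inner :: "'a set \<Rightarrow> ('a \<Rightarrow> 'a \<Rightarrow> bool) \<Rightarrow> 'a \<Rightarrow> 'a \<Rightarrow> 'a \<Rightarrow> 'a \<Rightarrow> 'a set" where
  "inner X le a b v w = interval X le a v \<inter> interval X le b w"

definition improper_4crown :: "'a set \<Rightarrow> ('a \<Rightarrow> 'a \<Rightarrow> bool) \<Rightarrow> 'a set \<Rightarrow> bool" where
  "improper_4crown X le D \<longleftrightarrow>
     D \<subseteq> X \<and> n_crown 4 D le \<and>
     (\<exists>a b v w. min_points D le = {a, b} \<and> max_points D le = {v, w} \<and> inner X le a b v w \<noteq> {})"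

definition order_hom ::
  "'a set \<Rightarrow> ('a \<Rightarrow> 'a \<Rightarrow> bool) \<Rightarrow> 'b set \<Rightarrow> ('b \<Rightarrow> 'b \<Rightarrow> bool) \<Rightarrow> ('a \<Rightarrow> 'b) \<Rightarrow> bool" where
  "order_hom X leX Y leY f \<longleftrightarrow> f \<in> X \<rightarrow> Y \<and> monotone_on X leX leY f"

definition retraction_of :: "'a set \<Rightarrow> ('a \<Rightarrow> 'a \<Rightarrow> bool) \<Rightarrow> ('a \<Rightarrow> 'a) \<Rightarrow> bool" where
  "retraction_of X le r \<longleftrightarrow> order_hom X le X le r \<and> (\<forall>x\<in>X. r (r x) = r x)"

definition is_retract :: "'a set \<Rightarrow> ('a \<Rightarrow> 'a \<Rightarrow> bool) \<Rightarrow> 'a set \<Rightarrow> bool" where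
  "is_retract X le Y \<longleftrightarrow> (\<exists>r. retraction_of X le r \<and> r ` X = Y)"

text \<open>
  Undirected multigraphs with two kinds of edges, and at most one edge of each kind between two
  (possibly equal) vertices.
\<close>

record 'v lu_graph =
  verts :: "'v set"
  L_edge :: "'v \<Rightarrow> 'v \<Rightarrow> bool"
  U_edge :: "'v \<Rightarrow> 'v \<Rightarrow> bool"

definition lu_hom :: "'v lu_graph \<Rightarrow> 'w lu_graph \<Rightarrow> ('v \<Rightarrow> 'w) \<Rightarrow> bool" where
  "lu_hom G H \<phi> \<longleftrightarrow>
     \<phi> \<in> verts G \<rightarrow> verts H \<and>
     (\<forall>S\<in>verts G. \<forall>T\<in>verts G. L_edge G S T \<longrightarrow> L_edge H (\<phi> S) (\<phi> T)) \<and>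
     (\<forall>S\<in>verts G. \<forall>T\<in>verts G. U_edge G S T \<longrightarrow> U_edge H (\<phi> S) (\<phi> T))"

definition intersection_graph ::
  "'a set \<Rightarrow> ('a \<Rightarrow> 'a \<Rightarrow> bool) \<Rightarrow> 'a set set \<Rightarrow> 'a set lu_graph" where
  "intersection_graph X le \<S> =
     \<lparr> verts = \<S>,
       L_edge = (\<lambda>S T. S \<in> \<S> \<and> T \<in> \<S> \<and> min_points X le \<inter> S \<inter> T \<noteq> {}),
       U_edge = (\<lambda>S T. S \<in> \<S> \<and> T \<in> \<S> \<and> max_points X le \<inter> S \<inter> T \<noteq> {}) \<rparr>"

definition C23 :: "'b set \<Rightarrow> ('b \<Rightarrow> 'b \<Rightarrow> bool) \<Rightarrow> 'b set set" where
  "C23 C leC = {S. S \<subseteq> C \<and> (card S = 2 \<or> card S = 3) \<and> connected_poset S leC}"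

definition C_graph :: "'b set \<Rightarrow> ('b \<Rightarrow> 'b \<Rightarrow> bool) \<Rightarrow> 'b set lu_graph" where
  "C_graph C leC = intersection_graph C leC (C23 C leC)"

definition improper_crowns :: "'a set \<Rightarrow> ('a \<Rightarrow> 'a \<Rightarrow> bool) \<Rightarrow> 'a set set" where
  "improper_crowns X le = {F. F \<subseteq> ext_points X le \<and> improper_4crown X le F}"

definition F_graph :: "'a set \<Rightarrow> ('a \<Rightarrow> 'a \<Rightarrow> bool) \<Rightarrow> 'a set lu_graph" where
  "F_graph X le = intersection_graph X le (improper_crowns X le)"

text \<open>
  For a 4-crown \<open>C\<close> with minimal points \<open>a, b\<close> and maximal points \<open>v, w\<close>, the families
  \<open>\<A>, \<B>\<close> are \<open>L_class C leC a\<close>, \<open>L_class C leC b\<close>, and \<open>\<V>, \<W>\<close> are \<open>U_class C leC v\<close>,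
  \<open>U_class C leC w\<close>.
\<close>

definition L_class :: "'b set \<Rightarrow> ('b \<Rightarrow> 'b \<Rightarrow> bool) \<Rightarrow> 'b \<Rightarrow> 'b set set" where
  "L_class C leC c = {S \<in> C23 C leC. min_points C leC \<inter> S = {c}}"

definition U_class :: "'b set \<Rightarrow> ('b \<Rightarrow> 'b \<Rightarrow> bool) \<Rightarrow> 'b \<Rightarrow> 'b set set" where
  "U_class C leC c = {S \<in> C23 C leC. max_points C leC \<inter> S = {c}}"

definition separating_witnesses ::
  "'a set \<Rightarrow> ('a \<Rightarrow> 'a \<Rightarrow> bool) \<Rightarrow> 'b set \<Rightarrow> ('b \<Rightarrow> 'b \<Rightarrow> bool) \<Rightarrow> 'b \<Rightarrow> 'b \<Rightarrow> 'b \<Rightarrow> 'b \<Rightarrow>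
   ('a set \<Rightarrow> 'b set) \<Rightarrow> 'a \<Rightarrow> 'a \<Rightarrow> 'a \<Rightarrow> 'a \<Rightarrow> bool" where
  "separating_witnesses X le C leC a b v w \<phi> x x' y y' \<longleftrightarrow>
     x \<in> min_points X le \<and> x' \<in> min_points X le \<and> x \<noteq> x' \<and>
     y \<in> max_points X le \<and> y' \<in> max_points X le \<and> y \<noteq> y' \<and>
     (\<forall>F\<in>improper_crowns X le.
        (x \<in> F \<longrightarrow> \<phi> F \<notin> L_class C leC a) \<and>
        (x' \<in> F \<longrightarrow> \<phi> F \<notin> L_class C leC b) \<and>
        (y \<in> F \<longrightarrow> \<phi> F \<notin> U_class C leC v) \<and>
        (y' \<in> F \<longrightarrow> \<phi> F \<notin> U_class C leC w))"

definition separating_hom ::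
  "'a set \<Rightarrow> ('a \<Rightarrow> 'a \<Rightarrow> bool) \<Rightarrow> 'b set \<Rightarrow> ('b \<Rightarrow> 'b \<Rightarrow> bool) \<Rightarrow> 'b \<Rightarrow> 'b \<Rightarrow> 'b \<Rightarrow> 'b \<Rightarrow>
   ('a set \<Rightarrow> 'b set) \<Rightarrow> bool" where
  "separating_hom X le C leC a b v w \<phi> \<longleftrightarrow>
     lu_hom (F_graph X le) (C_graph C leC) \<phi> \<and>
     (\<exists>x x' y y'. separating_witnesses X le C leC a b v w \<phi> x x' y y')"

definition D_separating_hom ::
  "'a set \<Rightarrow> 'a set \<Rightarrow> ('a \<Rightarrow> 'a \<Rightarrow> bool) \<Rightarrow> 'b set \<Rightarrow> ('b \<Rightarrow> 'b \<Rightarrow> bool) \<Rightarrow> 'b \<Rightarrow> 'b \<Rightarrow> 'b \<Rightarrow> 'b \<Rightarrow>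
   ('a set \<Rightarrow> 'b set) \<Rightarrow> bool" where
  "D_separating_hom D X le C leC a b v w \<phi> \<longleftrightarrow>
     lu_hom (F_graph X le) (C_graph C leC) \<phi> \<and>
     (\<exists>x x' y y'. separating_witnesses X le C leC a b v w \<phi> x x' y y' \<and> {x, x', y, y'} = D)"

end

theory Submission
  imports Defs
begin

text \<open>
  A surjection \<open>f\<close> of \<open>P\<close> onto \<open>C\<close> can be changed on extremal points so that it maps minimal points
  to minimal points and maximal points to maximal points; then \<open>F \<mapsto> f(F)\<close> is separating, because
  the image of an inner point of \<open>F\<close> prevents \<open>f(F)\<close> from being all of \<open>C\<close>.
  Conversely, for a separating \<open>\<phi>\<close> and an extremal point \<open>p\<close>, the traces of the sets \<open>\<phi>(F)\<close>, \<open>p \<in> F\<close>,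
  on the level of \<open>C\<close> corresponding to \<open>p\<close> intersect pairwise, and since this level has two points
  only, they have a common point, which is chosen as \<open>f(p)\<close>. Were \<open>f\<close> non-constant both on the
  minimal points below \<open>m\<close> and on the maximal points above \<open>m\<close>, some \<open>\<phi>(F)\<close> would have four
  points; so \<open>f(m)\<close> can be defined as one of these constants.
  For the retraction, \<open>f\<close> acts on \<open>C\<close> as an involution, hence \<open>f \<circ> f\<close> is as required.
\<close>

section \<open>Extremal points and connectedness in finite posets\<close>

lemma min_points_subset: "min_points X le \<subseteq> X"
  by (auto simp: min_points_def)

lemma max_points_subset: "max_points X le \<subseteq> X"
  by (auto simp: max_points_def)

lemma min_pointsD: "p \<in> min_points X le \<Longrightarrow> q \<in> X \<Longrightarrow> le q p \<Longrightarrow> q = p"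
  by (auto simp: min_points_def)

lemma max_pointsD: "p \<in> max_points X le \<Longrightarrow> q \<in> X \<Longrightarrow> le p q \<Longrightarrow> q = p"
  by (auto simp: max_points_def)

lemma finite_poset_refl: "finite_poset X le \<Longrightarrow> x \<in> X \<Longrightarrow> le x x"
  by (auto simp: finite_poset_def dest: reflp_onD)

lemma finite_poset_antisym:
  "finite_poset X le \<Longrightarrow> x \<in> X \<Longrightarrow> y \<in> X \<Longrightarrow> le x y \<Longrightarrow> le y x \<Longrightarrow> x = y"
  by (auto simp: finite_poset_def dest: antisymp_onD)

lemma finite_poset_trans:
  "finite_poset X le \<Longrightarrow> x \<in> X \<Longrightarrow> y \<in> X \<Longrightarrow> z \<in> X \<Longrightarrow> le x y \<Longrightarrow> le y z \<Longrightarrow> le x z"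
  unfolding finite_poset_def by (meson transp_onD)

lemma finite_poset_subset:
  "finite_poset X le \<Longrightarrow> Y \<subseteq> X \<Longrightarrow> Y \<noteq> {} \<Longrightarrow> finite_poset Y le"
  unfolding finite_poset_def
  by (meson finite_subset reflp_on_subset antisymp_on_subset transp_on_subset)

lemma ex_min_point_below:
  assumes P: "finite_poset X le" and m: "m \<in> X"
  shows "\<exists>p \<in> min_points X le. le p m"
proof -
  let ?D = "{x \<in> X. le x m}" and ?R = "\<lambda>x y. le x y \<and> x \<noteq> y"
  have "finite ?D" "?D \<noteq> {}"
    using P m finite_poset_refl[OF P] by (auto simp: finite_poset_def)
  moreover have "asymp_on ?D ?R"
    using finite_poset_antisym[OF P] by (auto intro!: asymp_onI)
  moreover have "transp_on ?D ?R"
    using finite_poset_antisym[OF P] finite_poset_trans[OF P]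
    by (intro transp_onI) blast
  ultimately obtain p where p: "p \<in> ?D" "\<forall>x\<in>?D. x \<noteq> p \<longrightarrow> \<not> ?R x p"
    using Finite_Set.bex_min_element[of ?D ?R] by blast
  \<comment> \<open>The points below \<open>m\<close> form a downward closed set, so a minimal point
    of it is minimal in \<open>X\<close>.\<close>
  have "q = p" if "q \<in> X" "le q p" for q
  proof (rule ccontr)
    assume "q \<noteq> p"
    moreover have "le q m" using finite_poset_trans[OF P that(1) _ m that(2)] p(1) by simp
    ultimately show False using p that by simp
  qed
  then have "p \<in> min_points X le" using p(1) by (simp add: min_points_def)
  then show ?thesis using p by blast
qed

lemma ex_max_point_above:
  assumes P: "finite_poset X le" and m: "m \<in> X"
  shows "\<exists>p \<in> max_points X le. le m p"
proof -
  have "finite_poset X (\<lambda>x y. le y x)"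
    using P unfolding finite_poset_def
    by (auto intro!: reflp_onI antisymp_onI transp_onI
        dest: reflp_onD antisymp_onD transp_onD)
  from ex_min_point_below[OF this m] show ?thesis
    by (simp add: min_points_def max_points_def)
qed

text \<open>A point on both levels would be isolated in the comparability graph, whereas
  connectedness and a second point give it a neighbour. Disjointness allows values to be prescribed
  on the two levels independently.\<close>

lemma min_max_disjoint:
  assumes con: "connected_poset X le" and 2: "card (min_points X le) \<ge> 2"
  shows "min_points X le \<inter> max_points X le = {}"
proof (rule ccontr)
  assume "min_points X le \<inter> max_points X le \<noteq> {}"
  then obtain p where p: "p \<in> min_points X le" "p \<in> max_points X le" by auto
  then have pX: "p \<in> X" using min_points_subset[of X le] by blast
  have "min_points X le \<noteq> {p}" using 2 by auto
  then obtain q where q: "q \<in> X" "q \<noteq> p" using p(1) min_points_subset[of X le] by auto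
  have "(comparability_edge X le)\<^sup>*\<^sup>* p q"
    using con pX q by (auto simp: connected_poset_def)
  then obtain r where "comparability_edge X le p r"
    using q(2) by (metis converse_rtranclpE)
  then show False
    using p by (auto simp: comparability_edge_def dest: min_pointsD max_pointsD)
qed

text \<open>Any two points are joined by a path through the centre \<open>c\<close>.\<close>

lemma connected_poset_star:
  assumes "c \<in> S" "\<And>x. x \<in> S \<Longrightarrow> le c x \<or> le x c"
  shows "connected_poset S le"
proof -
  have "(comparability_edge S le)\<^sup>*\<^sup>* x c \<and> (comparability_edge S le)\<^sup>*\<^sup>* c x" if "x \<in> S" for x
  proof (cases "x = c")
    case False
    then have "comparability_edge S le x c" "comparability_edge S le c x"
      using assms that by (auto simp: comparability_edge_def)
    then show ?thesis by blast
  qed simp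
  then show ?thesis unfolding connected_poset_def by (meson rtranclp_trans)
qed

section \<open>4-crowns and improper 4-crowns\<close>

text \<open>By transitivity, two consecutive edges of the cycle pointing in the same direction would
  make opposite vertices comparable. Hence the directions alternate.\<close>

lemma four_crown_structure:
  assumes P: "finite_poset C le" and crown: "n_crown 4 C le"
    and L: "min_points C le = {a, b}" and U: "max_points C le = {v, w}"
  shows "C = {a, b, v, w}" "distinct [a, b, v, w]" "le a v" "le a w" "le b v" "le b w"
proof -
  have card: "card C = 4" using crown by (simp add: n_crown_def)
  obtain n f where bij: "bij_betw f {..<n} C"
    and edge: "\<forall>i<n. \<forall>j<n. comparability_edge C le (f i) (f j) \<longleftrightarrow>
           j = Suc i mod n \<or> i = Suc j mod n"
    using crown unfolding n_crown_def crown_def by blast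
  have n: "n = 4" using bij_betw_same_card[OF bij] card by simp
  have four: "{..<4::nat} = {0, 1, 2, 3}" by auto
  have C: "C = {f 0, f 1, f 2, f 3}"
    using bij unfolding bij_betw_def n four by auto
  have ne: "f 0 \<noteq> f 1" "f 0 \<noteq> f 2" "f 0 \<noteq> f 3" "f 1 \<noteq> f 2" "f 1 \<noteq> f 3" "f 2 \<noteq> f 3"
    using bij unfolding bij_betw_def n four by (auto simp: inj_on_def)
  have comp: "le (f i) (f j) \<or> le (f j) (f i) \<longleftrightarrow> j = Suc i mod 4 \<or> i = Suc j mod 4"
    if "i < 4" "j < 4" "i \<noteq> j" for i j
    using edge that bij unfolding n comparability_edge_def bij_betw_def inj_on_def by blast
  have c: "le (f 0) (f 1) \<or> le (f 1) (f 0)" "le (f 1) (f 2) \<or> le (f 2) (f 1)"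
    "le (f 2) (f 3) \<or> le (f 3) (f 2)" "le (f 3) (f 0) \<or> le (f 0) (f 3)"
    "\<not> le (f 0) (f 2)" "\<not> le (f 2) (f 0)" "\<not> le (f 1) (f 3)" "\<not> le (f 3) (f 1)"
    using comp[of 0 1] comp[of 1 2] comp[of 2 3] comp[of 3 0] comp[of 0 2] comp[of 1 3] by auto
  have fC: "f 0 \<in> C" "f 1 \<in> C" "f 2 \<in> C" "f 3 \<in> C" using C by auto
  \<comment> \<open>The lower level consists of the even or of the odd positions of the
    cycle.\<close>
  consider (up) "le (f 0) (f 1)" "le (f 2) (f 1)" "le (f 2) (f 3)" "le (f 0) (f 3)"
    "\<not> le (f 1) (f 0)" "\<not> le (f 1) (f 2)" "\<not> le (f 3) (f 2)" "\<not> le (f 3) (f 0)"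
    | (down) "le (f 1) (f 0)" "le (f 1) (f 2)" "le (f 3) (f 2)" "le (f 3) (f 0)"
    "\<not> le (f 0) (f 1)" "\<not> le (f 2) (f 1)" "\<not> le (f 2) (f 3)" "\<not> le (f 0) (f 3)"
    using c finite_poset_trans[OF P] fC by metis
  then have "C = {a, b, v, w} \<and> distinct [a, b, v, w] \<and> le a v \<and> le a w \<and> le b v \<and> le b w"
  proof cases
    case up
    have "min_points C le = {f 0, f 2}" "max_points C le = {f 1, f 3}"
      using up c ne unfolding min_points_def max_points_def C by auto
    then have "{a, b} = {f 0, f 2}" "{v, w} = {f 1, f 3}" using L U by auto
    then show ?thesis using up C ne by (auto simp: doubleton_eq_iff)
  next
    case down
    have "min_points C le = {f 1, f 3}" "max_points C le = {f 0, f 2}"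
      using down c ne unfolding min_points_def max_points_def C by auto
    then have "{a, b} = {f 1, f 3}" "{v, w} = {f 0, f 2}" using L U by auto
    then show ?thesis using down C ne by (auto simp: doubleton_eq_iff)
  qed
  then show "C = {a, b, v, w}" "distinct [a, b, v, w]" "le a v" "le a w" "le b v" "le b w"
    by auto
qed

text \<open>The inner point \<open>m\<close> puts both lower points of the crown below both upper
  ones; as all four are distinct and extremal in \<open>X\<close>, this decides on which level of
  \<open>X\<close> each of them lies.\<close>

lemma improper_crowns_structure:
  assumes P: "finite_poset X le" and F: "F \<in> improper_crowns X le"
  obtains p q s t m where "F = {p, q, s, t}" "{p, q} \<subseteq> min_points X le"
    "{s, t} \<subseteq> max_points X le" "m \<in> X" "le p m" "le q m" "le m s" "le m t"
proof -
  have FE: "F \<subseteq> ext_points X le" and card: "card F = 4" and FX: "F \<subseteq> X"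
    using F by (auto simp: improper_crowns_def improper_4crown_def n_crown_def)
  obtain p q s t m where mm: "min_points F le = {p, q}" "max_points F le = {s, t}"
    and m: "m \<in> inner X le p q s t"
    using F unfolding improper_crowns_def improper_4crown_def by blast
  have m: "m \<in> X" "le p m" "le q m" "le m s" "le m t"
    using m by (auto simp: inner_def interval_def up_set_def down_set_def)
  \<comment> \<open>Extremal points of \<open>X\<close> that lie in \<open>F\<close> stay extremal
    in \<open>F\<close>, so the two pairs exhaust \<open>F\<close>.\<close>
  have "F \<subseteq> min_points F le \<union> max_points F le"
    using FE FX by (auto simp: ext_points_def min_points_def max_points_def)
  then have Feq: "F = {p, q, s, t}"
    using mm min_points_subset[of F le] max_points_subset[of F le] by auto
  have dist: "distinct [p, q, s, t]"
    using card unfolding Feq by (auto simp: card_insert_if split: if_splits)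
  have X: "p \<in> X" "q \<in> X" "s \<in> X" "t \<in> X" using Feq FX by auto
  note tr = finite_poset_trans[OF P _ m(1)]
  have le: "le p s" "le p t" "le q s" "le q t" using X m tr by auto
  have "{p, q} \<subseteq> min_points X le"
    using FE Feq le dist X by (auto simp: ext_points_def dest: max_pointsD)
  moreover have "{s, t} \<subseteq> max_points X le"
    using FE Feq le dist X by (auto simp: ext_points_def dest: min_pointsD)
  ultimately show ?thesis using that Feq m by blast
qed

lemma improper_crownsI:
  assumes P: "finite_poset X le"
    and L: "{p, q} \<subseteq> min_points X le" and U: "{s, t} \<subseteq> max_points X le"
    and dist: "distinct [p, q, s, t]"
    and m: "m \<in> X" "le p m" "le q m" "le m s" "le m t"
  shows "{p, q, s, t} \<in> improper_crowns X le"
proof -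
  \<comment> \<open>Alternating between the levels, the list runs once around the cycle.\<close>
  let ?F = "{p, q, s, t}" and ?f = "\<lambda>i. [p, s, q, t] ! i"
  have X: "p \<in> X" "q \<in> X" "s \<in> X" "t \<in> X"
    using L U min_points_subset[of X le] max_points_subset[of X le] by auto
  have le: "le p s" "le p t" "le q s" "le q t"
    using X m finite_poset_trans[OF P _ m(1)] by auto
  have nle: "\<not> le p q" "\<not> le q p" "\<not> le s t" "\<not> le t s"
    "\<not> le s p" "\<not> le s q" "\<not> le t p" "\<not> le t q"
    using L U X dist by (auto dest: min_pointsD max_pointsD)
  have four: "{..<4::nat} = {0, 1, 2, 3}" by auto
  have "bij_betw ?f {..<4} ?F"
    using dist unfolding four bij_betw_def inj_on_def by (auto simp: eval_nat_numeral)
  moreover have "comparability_edge ?F le (?f i) (?f j) \<longleftrightarrow> j = Suc i mod 4 \<or> i = Suc j mod 4"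
    if "i < 4" "j < 4" for i j
  proof -
    have "i \<in> {0, 1, 2, 3}" "j \<in> {0, 1, 2, 3}" using that by auto
    then show ?thesis
      using dist le nle by (elim insertE emptyE) (auto simp: comparability_edge_def)
  qed
  ultimately have "crown ?F le"
    unfolding crown_def by (intro exI[of _ 4] conjI exI[of _ ?f]) auto
  moreover have "card ?F = 4" using dist by auto
  moreover have "min_points ?F le = {p, q}" "max_points ?F le = {s, t}"
    using dist le nle unfolding min_points_def max_points_def by auto
  moreover have "m \<in> inner X le p q s t"
    using m by (auto simp: inner_def interval_def up_set_def down_set_def)
  ultimately show ?thesis
    using L U X unfolding improper_crowns_def improper_4crown_def n_crown_def ext_points_def
    by blast
qed

section \<open>Graph homomorphisms and the selection of images\<close>

text \<open>Edges of \<open>C_graph\<close> include membership in \<open>C23\<close>; it follows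
  from the first conjunct, which \<open>conj_cong\<close> supplies when the edge conditions are
  compared.\<close>

lemma lu_hom_F_graph_C_graph_iff:
  "lu_hom (F_graph X le) (C_graph C leC) \<phi> \<longleftrightarrow>
     (\<forall>F\<in>improper_crowns X le. \<phi> F \<in> C23 C leC) \<and>
     (\<forall>F\<in>improper_crowns X le. \<forall>G\<in>improper_crowns X le.
        min_points X le \<inter> F \<inter> G \<noteq> {} \<longrightarrow> min_points C leC \<inter> \<phi> F \<inter> \<phi> G \<noteq> {}) \<and>
     (\<forall>F\<in>improper_crowns X le. \<forall>G\<in>improper_crowns X le.
        max_points X le \<inter> F \<inter> G \<noteq> {} \<longrightarrow> max_points C leC \<inter> \<phi> F \<inter> \<phi> G \<noteq> {})"
  unfolding lu_hom_def F_graph_def C_graph_def intersection_graph_def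
    lu_graph.simps Pi_iff
  by (rule conj_cong[OF refl], rule conj_cong) blast+

lemma notin_L_class: "d \<in> min_points C leC \<Longrightarrow> d \<in> S \<Longrightarrow> d \<noteq> c \<Longrightarrow> S \<notin> L_class C leC c"
  unfolding L_class_def by blast

lemma notin_U_class: "d \<in> max_points C leC \<Longrightarrow> d \<in> S \<Longrightarrow> d \<noteq> c \<Longrightarrow> S \<notin> U_class C leC c"
  unfolding U_class_def by blast

text \<open>Subsets of \<open>{c, d}\<close> that meet pairwise have a common point: if one of them
  is \<open>{c}\<close>, all contain \<open>c\<close>; otherwise all contain \<open>d\<close>. The
  conditions on \<open>x\<close> and \<open>x'\<close> permit the values \<open>d\<close> at
  \<open>x\<close> and \<open>c\<close> at \<open>x'\<close>. The lemma serves for both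
  levels.\<close>

lemma separating_selection:
  assumes meet: "\<And>p F G. p \<in> L \<Longrightarrow> F \<in> \<F> \<Longrightarrow> G \<in> \<F> \<Longrightarrow> p \<in> F \<Longrightarrow> p \<in> G \<Longrightarrow> {c, d} \<inter> \<phi> F \<inter> \<phi> G \<noteq> {}"
    and x: "\<And>F. F \<in> \<F> \<Longrightarrow> x \<in> F \<Longrightarrow> {c, d} \<inter> \<phi> F \<noteq> {c}"
    and x': "\<And>F. F \<in> \<F> \<Longrightarrow> x' \<in> F \<Longrightarrow> {c, d} \<inter> \<phi> F \<noteq> {d}"
    and "x \<noteq> x'"
  shows "\<exists>g. g x = d \<and> g x' = c \<and> (\<forall>p\<in>L. g p \<in> {c, d} \<and> (\<forall>F\<in>\<F>. p \<in> F \<longrightarrow> g p \<in> \<phi> F))"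
proof -
  \<comment> \<open>Apart from the prescribed values at \<open>x\<close> and \<open>x'\<close>, the
    default is \<open>d\<close>, replaced by \<open>c\<close> only when some trace is
    \<open>{c}\<close>.\<close>
  define g where "g p = (if p = x' \<or> p \<noteq> x \<and> (\<exists>F\<in>\<F>. p \<in> F \<and> {c, d} \<inter> \<phi> F = {c}) then c else d)"
    for p
  have "g p \<in> \<phi> F" if p: "p \<in> L" and F: "F \<in> \<F>" "p \<in> F" for p F
  proof (rule ccontr)
    assume *: "g p \<notin> \<phi> F"
    \<comment> \<open>Equal crowns, that is, the loops of the graphs, show that traces are
      nonempty.\<close>
    have FF: "{c, d} \<inter> \<phi> F \<noteq> {}" using meet[OF p F(1) F(1) F(2) F(2)] by auto
    consider "p = x'" | "p \<noteq> x'" "p = x"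
      | G where "p \<noteq> x'" "p \<noteq> x" "G \<in> \<F>" "p \<in> G" "{c, d} \<inter> \<phi> G = {c}"
      | "p \<noteq> x'" "p \<noteq> x" "\<not> (\<exists>F\<in>\<F>. p \<in> F \<and> {c, d} \<inter> \<phi> F = {c})"
      by blast
    then show False
    proof cases
      case 1
      then show False using * FF x'[OF F(1)] F by (auto simp: g_def)
    next
      case 2
      then show False using * FF x[OF F(1)] F by (auto simp: g_def)
    next
      case 3
      then have "g p = c" unfolding g_def by auto
      moreover have "{c} \<inter> \<phi> F \<noteq> {}"
        using meet[OF p 3(3) F(1) 3(4) F(2)] unfolding 3(5) .
      ultimately show False using * by simp
    next
      case 4
      then have "g p = d" unfolding g_def by auto
      moreover have "{c, d} \<inter> \<phi> F \<noteq> {c}" using 4(3) F by blast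
      ultimately show False using * FF by auto
    qed
  qed
  then show ?thesis using \<open>x \<noteq> x'\<close> by (intro exI[of _ g]) (auto simp: g_def)
qed

section \<open>The target crown\<close>

locale four_crown =
  fixes C :: "'b set" and leC :: "'b \<Rightarrow> 'b \<Rightarrow> bool" and a b v w :: 'b
  assumes poset_C: "finite_poset C leC" and crown_C: "n_crown 4 C leC"
    and min_C: "min_points C leC = {a, b}" and max_C: "max_points C leC = {v, w}"
begin

lemmas C_eq = four_crown_structure(1)[OF poset_C crown_C min_C max_C]
  and C_distinct = four_crown_structure(2)[OF poset_C crown_C min_C max_C]
  and C_le = four_crown_structure(3-6)[OF poset_C crown_C min_C max_C]

lemma leC_iff:
  assumes "c \<in> C" "d \<in> C"
  shows "leC c d \<longleftrightarrow> c = d \<or> c \<in> {a, b} \<and> d \<in> {v, w}"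
proof
  assume "leC c d"
  then show "c = d \<or> c \<in> {a, b} \<and> d \<in> {v, w}"
    using assms C_eq min_pointsD[of d C leC c] max_pointsD[of c C leC d]
    unfolding min_C max_C by blast
next
  assume "c = d \<or> c \<in> {a, b} \<and> d \<in> {v, w}"
  then show "leC c d" using C_le finite_poset_refl[OF poset_C] assms by auto
qed

text \<open>The point \<open>c\<close> plays the role of the image of an inner point.\<close>

lemma C23_I:
  assumes "S = {l, l', u, u'}" "l \<in> {a, b}" "l' \<in> {a, b}" "u \<in> {v, w}" "u' \<in> {v, w}"
    and "c \<in> C" "leC l c" "leC l' c" "leC c u" "leC c u'"
  shows "S \<in> C23 C leC"
proof -
  have lu: "l \<in> C" "l' \<in> C" "u \<in> C" "u' \<in> C" using assms C_eq by auto
  have dist: "a \<noteq> b" "a \<noteq> v" "a \<noteq> w" "b \<noteq> v" "b \<noteq> w" "v \<noteq> w" using C_distinct by auto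
  \<comment> \<open>A lower \<open>c\<close> forces \<open>l = l' = c\<close>, an upper one forces
    \<open>u = u' = c\<close>; so at most three of the four points are distinct, and
    \<open>c\<close> is among them.\<close>
  have c: "l = c \<and> l' = c \<or> u = c \<and> u' = c"
    using assms lu dist by (auto simp: leC_iff)
  then have "connected_poset S leC"
    using assms by (intro connected_poset_star[of c]) auto
  moreover have "card S = 2 \<or> card S = 3"
    using c assms(1-5) dist by (auto simp: card_insert_if)
  ultimately show ?thesis using assms(1) lu by (auto simp: C23_def)
qed

end

section \<open>From order homomorphisms to separating homomorphisms\<close>

locale separated_poset =
  fixes X :: "'a set" and le :: "'a \<Rightarrow> 'a \<Rightarrow> bool"
  assumes poset_X: "finite_poset X le"
    and disjoint: "min_points X le \<inter> max_points X le = {}"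

locale poset_to_crown = separated_poset X le + four_crown C leC a b v w
  for X :: "'a set" and le C and leC :: "'b \<Rightarrow> 'b \<Rightarrow> bool" and a b v w
begin

abbreviation "L \<equiv> min_points X le"
abbreviation "U \<equiv> max_points X le"

text \<open>Minimal points sent to the upper level are moved to \<open>a\<close>, maximal points
  sent to the lower level to \<open>v\<close>. For \<open>p\<close> strictly below \<open>q\<close>
  this can only lower the value at \<open>p\<close> and raise the value at \<open>q\<close>. Values
  already on the right level are kept, so that preimages and fixed points survive.\<close>

lemma levelwise_hom:
  assumes f: "order_hom X le C leC f"
  obtains g where "order_hom X le C leC g" "g ` L \<subseteq> {a, b}" "g ` U \<subseteq> {v, w}"
    "\<And>p. p \<in> L \<Longrightarrow> f p \<in> {a, b} \<Longrightarrow> g p = f p"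
    "\<And>p. p \<in> U \<Longrightarrow> f p \<in> {v, w} \<Longrightarrow> g p = f p"
proof -
  define g where "g p = (if p \<in> L \<and> f p \<in> {v, w} then a
    else if p \<in> U \<and> f p \<in> {a, b} then v else f p)" for p
  have fC: "f p \<in> C" if "p \<in> X" for p using f that by (auto simp: order_hom_def)
  have gC: "g p \<in> C" if "p \<in> X" for p using fC[OF that] C_eq by (auto simp: g_def)
  have "leC (g p) (g q)" if pq: "p \<in> X" "q \<in> X" "le p q" for p q
  proof (cases "p = q")
    case True
    then show ?thesis using gC pq finite_poset_refl[OF poset_C] by auto
  next
    case False
    then have "p \<notin> U" "q \<notin> L" using pq by (auto dest: min_pointsD max_pointsD)
    moreover have "leC (f p) (f q)" using f pq by (auto simp: order_hom_def monotone_on_def)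
    ultimately show ?thesis
      using fC[OF pq(1)] fC[OF pq(2)] C_distinct C_eq leC_iff by (auto simp: g_def)
  qed
  then have "order_hom X le C leC g" using gC by (auto simp: order_hom_def monotone_on_def)
  moreover have "g ` L \<subseteq> {a, b}" "g ` U \<subseteq> {v, w}"
    using fC C_eq C_distinct disjoint min_points_subset[of X le] max_points_subset[of X le]
    by (auto simp: g_def)
  moreover have "g p = f p" if "p \<in> L" "f p \<in> {a, b}" for p
    using that C_distinct disjoint by (auto simp: g_def)
  moreover have "g p = f p" if "p \<in> U" "f p \<in> {v, w}" for p
    using that C_distinct disjoint by (auto simp: g_def)
  ultimately show ?thesis using that[of g] by blast
qed

text \<open>A minimal point below a preimage of \<open>c\<close> has its image below the minimal
  point \<open>c\<close>, hence equal to it; dually for maximal points.\<close>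

lemma surjective_levels:
  assumes f: "order_hom X le C leC f" and surj: "f ` X = C"
  shows "{a, b} \<subseteq> f ` L" "{v, w} \<subseteq> f ` U"
proof -
  have mono: "leC (f p) (f q)" if "p \<in> X" "q \<in> X" "le p q" for p q
    using f that by (auto simp: order_hom_def monotone_on_def)
  have fC: "f p \<in> C" if "p \<in> X" for p using f that by (auto simp: order_hom_def)
  show "{a, b} \<subseteq> f ` L"
  proof
    fix c assume c: "c \<in> {a, b}"
    then have "c \<in> f ` X" using surj C_eq by auto
    then obtain m where m: "m \<in> X" "f m = c" by blast
    obtain p where p: "p \<in> L" "le p m" using ex_min_point_below[OF poset_X m(1)] by auto
    then have "f p = c"
      using mono[of p m] m c min_C min_pointsD[of c C leC "f p"] fC min_points_subset[of X le]
      by auto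
    then show "c \<in> f ` L" using p by auto
  qed
  show "{v, w} \<subseteq> f ` U"
  proof
    fix c assume c: "c \<in> {v, w}"
    then have "c \<in> f ` X" using surj C_eq by auto
    then obtain m where m: "m \<in> X" "f m = c" by blast
    obtain p where p: "p \<in> U" "le m p" using ex_max_point_above[OF poset_X m(1)] by auto
    then have "f p = c"
      using mono[of m p] m c max_C max_pointsD[of c C leC "f p"] fC max_points_subset[of X le]
      by auto
    then show "c \<in> f ` U" using p by auto
  qed
qed

text \<open>Edges are preserved because a common extremal point has its image in both sets. The
  witnesses are crossed: \<open>x \<in> F\<close> puts \<open>b\<close> into the image of
  \<open>F\<close>, so its lower trace is not \<open>{a}\<close>.\<close>

lemma image_hom_separating:
  assumes g: "order_hom X le C leC g" and gL: "g ` L \<subseteq> {a, b}" and gU: "g ` U \<subseteq> {v, w}"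
    and x: "x \<in> L" "g x = b" "x' \<in> L" "g x' = a"
    and y: "y \<in> U" "g y = w" "y' \<in> U" "g y' = v"
  shows "lu_hom (F_graph X le) (C_graph C leC) (\<lambda>F. g ` F)"
    and "separating_witnesses X le C leC a b v w (\<lambda>F. g ` F) x x' y y'"
proof -
  have mono: "leC (g p) (g q)" if "p \<in> X" "q \<in> X" "le p q" for p q
    using g that by (auto simp: order_hom_def monotone_on_def)
  have in_C23: "g ` F \<in> C23 C leC" if "F \<in> improper_crowns X le" for F
    using poset_X that
  proof (rule improper_crowns_structure)
    fix p q s t m
    assume F: "F = {p, q, s, t}" "{p, q} \<subseteq> L" "{s, t} \<subseteq> U" "m \<in> X"
      "le p m" "le q m" "le m s" "le m t"
    then have "p \<in> X" "q \<in> X" "s \<in> X" "t \<in> X"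
      using min_points_subset[of X le] max_points_subset[of X le] by auto
    \<comment> \<open>The image of the inner point \<open>m\<close> is the point \<open>c\<close> of
      \<open>C23_I\<close>.\<close>
    then show ?thesis
      using F gL gU g mono by (intro C23_I[of _ "g p" "g q" "g s" "g t" "g m"])
        (auto simp: order_hom_def)
  qed
  show "lu_hom (F_graph X le) (C_graph C leC) (\<lambda>F. g ` F)"
    unfolding lu_hom_F_graph_C_graph_iff min_C max_C
  proof (intro conjI ballI impI)
    fix F assume "F \<in> improper_crowns X le"
    then show "g ` F \<in> C23 C leC" by (rule in_C23)
  next
    fix F G assume "L \<inter> F \<inter> G \<noteq> {}"
    then show "{a, b} \<inter> g ` F \<inter> g ` G \<noteq> {}" using gL by blast
  next
    fix F G assume "U \<inter> F \<inter> G \<noteq> {}"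
    then show "{v, w} \<inter> g ` F \<inter> g ` G \<noteq> {}" using gU by blast
  qed
  have neq: "a \<noteq> b" "v \<noteq> w" using C_distinct by auto
  then have "x \<noteq> x'" "y \<noteq> y'" using x y by auto
  moreover have "g ` F \<notin> L_class C leC a" if "x \<in> F" for F
    using that x neq by (intro notin_L_class[of b]) (auto simp: min_C)
  moreover have "g ` F \<notin> L_class C leC b" if "x' \<in> F" for F
    using that x neq by (intro notin_L_class[of a]) (auto simp: min_C)
  moreover have "g ` F \<notin> U_class C leC v" if "y \<in> F" for F
    using that y neq by (intro notin_U_class[of w]) (auto simp: max_C)
  moreover have "g ` F \<notin> U_class C leC w" if "y' \<in> F" for F
    using that y neq by (intro notin_U_class[of v]) (auto simp: max_C)
  ultimately show "separating_witnesses X le C leC a b v w (\<lambda>F. g ` F) x x' y y'"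
    using x(1,3) y(1,3) by (simp add: separating_witnesses_def)
qed

section \<open>From separating homomorphisms to order homomorphisms\<close>

text \<open>By \<open>const\<close>, \<open>g\<close> is constant on the minimal points below
  \<open>m\<close> or on the maximal points above \<open>m\<close>; outside \<open>U\<close> the
  lower constant is preferred. Going up, the set of lower values grows and the set of upper values
  shrinks, so a value on the upper level is never followed by one on the lower level.\<close>

lemma extend_from_levels:
  assumes gL: "\<And>p. p \<in> L \<Longrightarrow> g p \<in> {a, b}" and gU: "\<And>p. p \<in> U \<Longrightarrow> g p \<in> {v, w}"
    and const: "\<And>m p q s t. m \<in> X \<Longrightarrow> p \<in> L \<Longrightarrow> q \<in> L \<Longrightarrow> s \<in> U \<Longrightarrow> t \<in> U \<Longrightarrow>
      le p m \<Longrightarrow> le q m \<Longrightarrow> le m s \<Longrightarrow> le m t \<Longrightarrow> g p = g q \<or> g s = g t"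
  obtains f where "order_hom X le C leC f" "\<And>p. p \<in> L \<union> U \<Longrightarrow> f p = g p"
proof -
  define D where "D m = g ` {p \<in> L. le p m}" for m
  define V where "V m = g ` {s \<in> U. le m s}" for m
  \<comment> \<open>Maximal points come first, because \<open>D m\<close> may be a singleton there
    as well. At a minimal point \<open>D m\<close> is \<open>{g m}\<close>, so the second branch
    returns \<open>g m\<close>.\<close>
  define f where "f m = (if m \<in> U then g m else if \<exists>c. D m = {c} then the_elem (D m)
    else the_elem (V m))" for m
  note tr = finite_poset_trans[OF poset_X]
  have LX: "L \<subseteq> X" and UX: "U \<subseteq> X"
    using min_points_subset[of X le] max_points_subset[of X le] by auto
  have D_ne: "D m \<noteq> {}" "D m \<subseteq> {a, b}" if "m \<in> X" for m
    using ex_min_point_below[OF poset_X that] gL by (auto simp: D_def)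
  have V_ne: "V m \<noteq> {}" "V m \<subseteq> {v, w}" if "m \<in> X" for m
    using ex_max_point_above[OF poset_X that] gU by (auto simp: V_def)
  have DV: "(\<exists>c. D m = {c}) \<or> (\<exists>c. V m = {c})" if m: "m \<in> X" for m
  proof (rule ccontr)
    assume "\<not> ?thesis"
    then obtain c c' d d' where "c \<in> D m" "c' \<in> D m" "c \<noteq> c'" "d \<in> V m" "d' \<in> V m" "d \<noteq> d'"
      using D_ne(1)[OF m] V_ne(1)[OF m] by blast
    then show False using const[OF m] unfolding D_def V_def by blast
  qed
  have D_mono: "D m \<subseteq> D m'" and V_mono: "V m' \<subseteq> V m"
    if "m \<in> X" "m' \<in> X" "le m m'" for m m'
    using that tr LX UX unfolding D_def V_def by blast+
  \<comment> \<open>A value in \<open>{a, b}\<close> is the lower constant; a value in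
    \<open>{v, w}\<close> outside \<open>U\<close> means that the lower values are not
    constant.\<close>
  have f_cases: "f m \<in> {a, b} \<and> D m = {f m} \<or>
      f m \<in> {v, w} \<and> (m \<in> U \<and> f m = g m \<or> m \<notin> U \<and> V m = {f m} \<and> (\<nexists>c. D m = {c}))"
    if m: "m \<in> X" for m
  proof -
    consider "m \<in> U" | c where "m \<notin> U" "D m = {c}" | c where "m \<notin> U" "\<nexists>c. D m = {c}" "V m = {c}"
      using DV[OF m] by blast
    then show ?thesis
      using gU D_ne[OF m] V_ne[OF m] by cases (auto simp: f_def)
  qed
  have fC: "f m \<in> C" if "m \<in> X" for m using f_cases[OF that] C_eq by auto
  have fU: "f m = g m" if "m \<in> U" for m using that by (simp add: f_def)
  have fL: "f m = g m" if m: "m \<in> L" for m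
  proof -
    have "m \<in> X" using m LX by auto
    then have "{p \<in> L. le p m} = {m}"
      using m LX finite_poset_refl[OF poset_X] by (auto dest: min_pointsD)
    then show ?thesis using m disjoint by (auto simp: f_def D_def)
  qed
  have "leC (f m) (f m')" if mm: "m \<in> X" "m' \<in> X" "le m m'" for m m'
  proof (cases "m = m'")
    case True
    then show ?thesis using fC mm finite_poset_refl[OF poset_C] by auto
  next
    case False
    then have mU: "m \<notin> U" using mm by (auto dest: max_pointsD)
    have ab: "leC (f m) (f m')" if "f m \<in> {a, b}" "f m' \<in> {v, w}"
      using that fC mm leC_iff by blast
    have "f m = f m'" if "f m \<in> {a, b}" "f m' \<in> {a, b}"
      using that f_cases[OF mm(1)] f_cases[OF mm(2)] D_mono[OF mm] C_distinct by auto
    \<comment> \<open>Non-constant lower values at \<open>m\<close> persist at \<open>m'\<close>, so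
      \<open>f m'\<close> is on the upper level as well and belongs to
      \<open>V m = {f m}\<close>.\<close>
    moreover have "f m = f m'" if fm: "f m \<in> {v, w}"
    proof -
      have Vm: "V m = {f m}" "\<nexists>c. D m = {c}"
        using f_cases[OF mm(1)] fm C_distinct mU by auto
      have D: "\<nexists>c. D m' = {c}"
        using Vm(2) D_mono[OF mm] D_ne(1)[OF mm(1)] by (metis subset_singletonD)
      show ?thesis
      proof (cases "m' \<in> U")
        case True
        then have "f m' \<in> V m" using mm fU by (auto simp: V_def)
        then show ?thesis using Vm by auto
      next
        case False
        then have "V m' = {f m'}" using f_cases[OF mm(2)] D by auto
        then show ?thesis using V_mono[OF mm] Vm by auto
      qed
    qed
    ultimately show ?thesis
      using ab fC[OF mm(1)] fC[OF mm(2)] C_eq finite_poset_refl[OF poset_C fC[OF mm(1)]]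
      by auto
  qed
  then have "order_hom X le C leC f" using fC by (auto simp: order_hom_def monotone_on_def)
  then show ?thesis using that fL fU by blast
qed

text \<open>Values are selected on each level separately and then extended. A crown through
  \<open>x\<close> is not sent to a set with lower trace \<open>{a}\<close>, which makes
  \<open>b\<close> a possible value at \<open>x\<close>.\<close>

lemma hom_of_separating:
  assumes hom: "lu_hom (F_graph X le) (C_graph C leC) \<phi>"
    and sep: "separating_witnesses X le C leC a b v w \<phi> x x' y y'"
  obtains f where "order_hom X le C leC f" "f x = b" "f x' = a" "f y = w" "f y' = v"
proof -
  let ?F = "improper_crowns X le"
  have wit: "x \<in> L" "x' \<in> L" "x \<noteq> x'" "y \<in> U" "y' \<in> U" "y \<noteq> y'"
    using sep by (auto simp: separating_witnesses_def)
  have C23: "\<phi> F \<in> C23 C leC" if "F \<in> ?F" for F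
    using hom that unfolding lu_hom_F_graph_C_graph_iff by blast
  have meetL: "{a, b} \<inter> \<phi> F \<inter> \<phi> G \<noteq> {}"
    if "p \<in> L" "F \<in> ?F" "G \<in> ?F" "p \<in> F" "p \<in> G" for p F G
    using hom that unfolding lu_hom_F_graph_C_graph_iff min_C by blast
  have meetU: "{v, w} \<inter> \<phi> F \<inter> \<phi> G \<noteq> {}"
    if "p \<in> U" "F \<in> ?F" "G \<in> ?F" "p \<in> F" "p \<in> G" for p F G
    using hom that unfolding lu_hom_F_graph_C_graph_iff max_C by blast
  have xs: "{a, b} \<inter> \<phi> F \<noteq> {a}" if "F \<in> ?F" "x \<in> F" for F
    using sep that C23 by (auto simp: separating_witnesses_def L_class_def min_C)
  have xs': "{a, b} \<inter> \<phi> F \<noteq> {b}" if "F \<in> ?F" "x' \<in> F" for F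
    using sep that C23 by (auto simp: separating_witnesses_def L_class_def min_C)
  have ys: "{v, w} \<inter> \<phi> F \<noteq> {v}" if "F \<in> ?F" "y \<in> F" for F
    using sep that C23 by (auto simp: separating_witnesses_def U_class_def max_C)
  have ys': "{v, w} \<inter> \<phi> F \<noteq> {w}" if "F \<in> ?F" "y' \<in> F" for F
    using sep that C23 by (auto simp: separating_witnesses_def U_class_def max_C)
  have "\<exists>g. g x = b \<and> g x' = a \<and>
      (\<forall>p\<in>L. g p \<in> {a, b} \<and> (\<forall>F\<in>?F. p \<in> F \<longrightarrow> g p \<in> \<phi> F))"
    using meetL xs xs' wit(3) by (intro separating_selection) blast+
  then obtain gL where gL: "gL x = b" "gL x' = a" "\<And>p. p \<in> L \<Longrightarrow> gL p \<in> {a, b}"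
    "\<And>p F. p \<in> L \<Longrightarrow> F \<in> ?F \<Longrightarrow> p \<in> F \<Longrightarrow> gL p \<in> \<phi> F"
    by blast
  have "\<exists>g. g y = w \<and> g y' = v \<and>
      (\<forall>p\<in>U. g p \<in> {v, w} \<and> (\<forall>F\<in>?F. p \<in> F \<longrightarrow> g p \<in> \<phi> F))"
    using meetU ys ys' wit(6) by (intro separating_selection) blast+
  then obtain gU where gU: "gU y = w" "gU y' = v" "\<And>p. p \<in> U \<Longrightarrow> gU p \<in> {v, w}"
    "\<And>p F. p \<in> U \<Longrightarrow> F \<in> ?F \<Longrightarrow> p \<in> F \<Longrightarrow> gU p \<in> \<phi> F"
    by blast
  define g where "g p = (if p \<in> L then gL p else gU p)" for p
  have g_L: "g p = gL p" if "p \<in> L" for p using that by (simp add: g_def)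
  have g_U: "g p = gU p" if "p \<in> U" for p using that disjoint by (auto simp: g_def)
  \<comment> \<open>Otherwise \<open>p, q, s, t\<close> form an improper crown with inner point
    \<open>m\<close>. Its image under \<open>\<phi>\<close> contains the four selected values and so
    equals \<open>C\<close>, but sets in \<open>C23\<close> have at most three points.\<close>
  have const: "g p = g q \<or> g s = g t"
    if H: "m \<in> X" "p \<in> L" "q \<in> L" "s \<in> U" "t \<in> U" "le p m" "le q m" "le m s" "le m t"
    for m p q s t
  proof (rule ccontr)
    assume ne: "\<not> ?thesis"
    then have "distinct [p, q, s, t]" using H disjoint by auto
    then have F: "{p, q, s, t} \<in> ?F" (is "?Q \<in> _")
      using H by (intro improper_crownsI[OF poset_X]) auto
    have sub: "{g p, g q, g s, g t} \<subseteq> \<phi> ?Q"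
      using gL(4)[OF _ F] gU(4)[OF _ F] H g_L g_U by auto
    have "g p \<in> {a, b}" "g q \<in> {a, b}" "g s \<in> {v, w}" "g t \<in> {v, w}"
      using gL(3) gU(3) H g_L g_U by auto
    then have "{g p, g q, g s, g t} = C" using ne C_eq by auto
    then have "\<phi> ?Q = C" using sub C23[OF F] by (auto simp: C23_def)
    then show False using C23[OF F] crown_C by (auto simp: C23_def n_crown_def)
  qed
  show ?thesis
  proof (rule extend_from_levels[of g])
    show "g p \<in> {a, b}" if "p \<in> L" for p using gL(3) g_L that by simp
    show "g p \<in> {v, w}" if "p \<in> U" for p using gU(3) g_U that by simp
    fix f assume f: "order_hom X le C leC f" "\<And>p. p \<in> L \<union> U \<Longrightarrow> f p = g p"
    show ?thesis using f wit gL gU g_L g_U by (intro that[of f]) auto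
  qed (rule const)
qed

section \<open>Surjections onto the crown\<close>

lemma surjection_iff_separating:
  "(\<exists>f. order_hom X le C leC f \<and> f ` X = C) \<longleftrightarrow> (\<exists>\<phi>. separating_hom X le C leC a b v w \<phi>)"
proof
  assume "\<exists>f. order_hom X le C leC f \<and> f ` X = C"
  then obtain f where f: "order_hom X le C leC f" "f ` X = C" by auto
  obtain g where g: "order_hom X le C leC g" "g ` L \<subseteq> {a, b}" "g ` U \<subseteq> {v, w}"
    "\<And>p. p \<in> L \<Longrightarrow> f p \<in> {a, b} \<Longrightarrow> g p = f p"
    "\<And>p. p \<in> U \<Longrightarrow> f p \<in> {v, w} \<Longrightarrow> g p = f p"
    using levelwise_hom[OF f(1)] by metis
  have "b \<in> f ` L" "a \<in> f ` L" "w \<in> f ` U" "v \<in> f ` U" using surjective_levels[OF f] by auto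
  then obtain x x' y y' where
    "x \<in> L" "f x = b" "x' \<in> L" "f x' = a" "y \<in> U" "f y = w" "y' \<in> U" "f y' = v"
    unfolding image_iff by metis
  \<comment> \<open>The values of \<open>f\<close> at these four points are on the right level, so
    passing to \<open>g\<close> keeps them.\<close>
  then have "x \<in> L" "g x = b" "x' \<in> L" "g x' = a" "y \<in> U" "g y = w" "y' \<in> U" "g y' = v"
    using g by auto
  from image_hom_separating[OF g(1-3) this] show "\<exists>\<phi>. separating_hom X le C leC a b v w \<phi>"
    unfolding separating_hom_def by blast
next
  assume "\<exists>\<phi>. separating_hom X le C leC a b v w \<phi>"
  then obtain \<phi> x x' y y' where hom: "lu_hom (F_graph X le) (C_graph C leC) \<phi>"
    and sep: "separating_witnesses X le C leC a b v w \<phi> x x' y y'"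
    unfolding separating_hom_def by blast
  obtain f where f: "order_hom X le C leC f" "f x = b" "f x' = a" "f y = w" "f y' = v"
    using hom_of_separating[OF hom sep] by blast
  moreover have "{x, x', y, y'} \<subseteq> X"
    using sep min_points_subset[of X le] max_points_subset[of X le]
    by (auto simp: separating_witnesses_def)
  ultimately have "C \<subseteq> f ` X" unfolding C_eq by auto
  then show "\<exists>f. order_hom X le C leC f \<and> f ` X = C"
    using f(1) by (auto simp: order_hom_def)
qed

end

section \<open>Retractions onto a crown of extremal points\<close>

locale poset_with_crown = poset_to_crown X le C le a b v w
  for X :: "'a set" and le C a b v w +
  assumes C_ext: "C \<subseteq> ext_points X le"
begin

lemma C_subset: "C \<subseteq> X"
  using C_ext min_points_subset[of X le] max_points_subset[of X le] by (auto simp: ext_points_def)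

text \<open>\<open>a\<close> and \<open>b\<close> have \<open>v\<close> strictly above them, so they
  are not maximal in \<open>X\<close>; being extremal, they are minimal. Dually for \<open>v\<close>
  and \<open>w\<close>.\<close>

lemma C_levels: "a \<in> L" "b \<in> L" "v \<in> U" "w \<in> U"
proof -
  have "a \<in> X" "b \<in> X" "v \<in> X" "w \<in> X" using C_subset C_eq by auto
  moreover have "a \<in> L \<union> U" "b \<in> L \<union> U" "v \<in> L \<union> U" "w \<in> L \<union> U"
    using C_ext C_eq by (auto simp: ext_points_def)
  ultimately show "a \<in> L" "b \<in> L" "v \<in> U" "w \<in> U"
    using C_le C_distinct by (auto dest: min_pointsD max_pointsD)
qed

lemma retract_iff_separating:
  "is_retract X le C \<longleftrightarrow> (\<exists>\<phi>. D_separating_hom C X le C le a b v w \<phi>)"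
proof
  assume "is_retract X le C"
  then obtain r where r: "order_hom X le X le r" "\<forall>x\<in>X. r (r x) = r x" "r ` X = C"
    by (auto simp: is_retract_def retraction_of_def)
  have fix_C: "r c = c" if "c \<in> C" for c using r that by auto
  have "order_hom X le C le r" using r by (auto simp: order_hom_def)
  then obtain g where g: "order_hom X le C le g" "g ` L \<subseteq> {a, b}" "g ` U \<subseteq> {v, w}"
    "\<And>p. p \<in> L \<Longrightarrow> r p \<in> {a, b} \<Longrightarrow> g p = r p"
    "\<And>p. p \<in> U \<Longrightarrow> r p \<in> {v, w} \<Longrightarrow> g p = r p"
    using levelwise_hom by metis
  \<comment> \<open>A retraction fixes its image pointwise, so the points of \<open>C\<close> keep
    their values in passing to \<open>g\<close> and serve as witnesses.\<close>
  have "r a = a" "r b = b" "r v = v" "r w = w" using fix_C C_eq by auto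
  then have "g b = b" "g a = a" "g w = w" "g v = v" using g C_levels by auto
  note image_hom_separating[OF g(1-3) C_levels(2) this(1) C_levels(1) this(2)
      C_levels(4) this(3) C_levels(3) this(4)]
  moreover have "{b, a, w, v} = C" using C_eq by auto
  ultimately show "\<exists>\<phi>. D_separating_hom C X le C le a b v w \<phi>"
    unfolding D_separating_hom_def by blast
next
  assume "\<exists>\<phi>. D_separating_hom C X le C le a b v w \<phi>"
  then obtain \<phi> x x' y y' where hom: "lu_hom (F_graph X le) (C_graph C le) \<phi>"
    and sep: "separating_witnesses X le C le a b v w \<phi> x x' y y'"
    and D: "{x, x', y, y'} = C"
    by (auto simp: D_separating_hom_def)
  obtain f where f: "order_hom X le C le f" "f x = b" "f x' = a" "f y = w" "f y' = v"
    using hom_of_separating[OF hom sep] by blast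
  have wit: "x \<in> L" "x' \<in> L" "x \<noteq> x'" "y \<in> U" "y' \<in> U" "y \<noteq> y'"
    using sep by (auto simp: separating_witnesses_def)
  have "x \<in> {a, b}" "x' \<in> {a, b}" "y \<in> {v, w}" "y' \<in> {v, w}"
    using wit D C_eq C_levels disjoint by auto
  \<comment> \<open>On each level of \<open>C\<close>, \<open>f\<close> fixes or swaps the two
    points, depending on which of them is the first witness; applying \<open>f\<close> twice fixes
    them in every case.\<close>
  then have ff: "f (f c) = c" if "c \<in> C" for c
    using that wit(3,6) f(2-5) unfolding C_eq by auto
  have fC: "f p \<in> C" if "p \<in> X" for p using f(1) that by (auto simp: order_hom_def)
  let ?r = "\<lambda>p. f (f p)"
  have rC: "?r p \<in> C" if "p \<in> X" for p using that fC C_subset by blast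
  have "monotone_on X le le ?r"
    using f(1) fC C_subset unfolding order_hom_def monotone_on_def by blast
  then have "retraction_of X le ?r"
    using rC ff C_subset by (auto simp: retraction_of_def order_hom_def)
  moreover have "?r ` X = C" using rC ff C_subset by (force simp: image_iff)
  ultimately show "is_retract X le C" by (auto simp: is_retract_def)
qed

end

theorem theorem1:
  fixes X :: "'a set" and le :: "'a \<Rightarrow> 'a \<Rightarrow> bool"
  assumes "finite_poset X le"
    and "connected_poset X le"
    and "card (min_points X le) \<ge> 2"
    and "card (max_points X le) \<ge> 2"
  shows
    "(\<forall>(C :: 'b set) leC a b v w.
        finite_poset C leC \<and> n_crown 4 C leC \<and>
        min_points C leC = {a, b} \<and> max_points C leC = {v, w} \<longrightarrow>
        ((\<exists>f. order_hom X le C leC f \<and> f ` X = C) \<longleftrightarrow>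
         (\<exists>\<phi>. separating_hom X le C leC a b v w \<phi>)))
     \<and>
     (\<forall>(C :: 'a set) a b v w.
        C \<subseteq> ext_points X le \<and> n_crown 4 C le \<and>
        min_points C le = {a, b} \<and> max_points C le = {v, w} \<longrightarrow>
        (is_retract X le C \<longleftrightarrow>
         (\<exists>\<phi>. D_separating_hom C X le C le a b v w \<phi>)))"
proof (intro conjI allI impI; elim conjE)
  have sep: "separated_poset X le"
    using assms(1) min_max_disjoint[OF assms(2,3)] by (rule separated_poset.intro)
  {
    fix C :: "'b set" and leC a b v w
    assume "finite_poset C leC" "n_crown 4 C leC"
      "min_points C leC = {a, b}" "max_points C leC = {v, w}"
    then have "poset_to_crown X le C leC a b v w"
      by (intro poset_to_crown.intro sep four_crown.intro)
    then show "(\<exists>f. order_hom X le C leC f \<and> f ` X = C) \<longleftrightarrow>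
         (\<exists>\<phi>. separating_hom X le C leC a b v w \<phi>)"
      by (rule poset_to_crown.surjection_iff_separating)
  next
    fix C :: "'a set" and a b v w
    assume C: "C \<subseteq> ext_points X le" "n_crown 4 C le"
      "min_points C le = {a, b}" "max_points C le = {v, w}"
    \<comment> \<open>In the second claim the poset axioms for \<open>C\<close> are inherited from
      \<open>X\<close>.\<close>
    have "C \<subseteq> X"
      using C(1) min_points_subset[of X le] max_points_subset[of X le]
      by (auto simp: ext_points_def)
    moreover have "C \<noteq> {}" using C(2) by (auto simp: n_crown_def)
    ultimately have "finite_poset C le" by (rule finite_poset_subset[OF assms(1)])
    with C have "poset_with_crown X le C a b v w"
      by (intro poset_with_crown.intro poset_to_crown.intro sep four_crown.intro
          poset_with_crown_axioms.intro)
    then show "is_retract X le C \<longleftrightarrow> (\<exists>\<phi>. D_separating_hom C X le C le a b v w \<phi>)"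
      by (rule poset_with_crown.retract_iff_separating)
  }
qed

end
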